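(* Let $X$ be a Banach space, $(A_n)_{n\in\mathbb Z}$ a sequence in $\mathcal B(X)$, $\mu=(\mu_n)_{n\in\mathbb Z}$ a growth rate and $\nu=(\nu_n)_{n\in\mathbb Z}$ a sequence with $\nu_n\ge1$ for all $n$. Suppose that there exists $\beta>0$ such that: (1) for each $\mathbf y=(y_n)_{n\in\mathbb Z}\in\ell^1_\beta$ there exists a unique $\mathbf x=(x_n)_{n\in\mathbb Z}\in\ell^\infty_\beta$ such that $x_{n+1}-A_nx_n=y_{n+1}$ for all $n\in\mathbb Z$; (2) for each $\mathbf y=(y_n)_{n\in\mathbb Z}\in\ell^1_{-\beta}$ there exists a unique $\mathbf x=(x_n)_{n\in\mathbb Z}\in\ell^\infty_{-\beta}$ such that $x_{n+1}-A_nx_n=y_{n+1}$ for all $n\in\mathbb Z$; (3) for each $\mathbf y=(y_n)_{n\in\mathbb Z}\in\ell^1_{\beta,|\cdot|}$ there exists a unique $\mathbf x=(x_n)_{n\in\mathbb Z}\in\ell^\infty_{\beta,|\cdot|}$ such that $x_{n+1}-A_nx_n=y_{n+1}$ for all $n\in\mathbb Z$. Then $(A_n)_{n\in\mathbb Z}$ admits a $(\mu,\nu)$-dichotomy.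
   Context: $(X,\|\cdot\|)$ is a Banach space and $\mathcal B(X)$ is the space of bounded linear operators on $X$ with the operator norm. A growth rate $\mu=(\mu_n)_{n\in\mathbb Z}$ is a strictly increasing sequence of positive numbers with $\lim_{n\to+\infty}\mu_n=+\infty$ and $\lim_{n\to-\infty}\mu_n=0$. For $m\ge n$, $\mathcal A(m,n)=A_{m-1}\cdots A_n$ if $m>n$ and $\mathcal A(n,n)=\mathrm{Id}$. $(\mu,\nu)$-dichotomy: $(A_n)_{n\in\mathbb Z}$ admits a $(\mu,\nu)$-dichotomy if (1) there are projections $P_n$ on $X$, $n\in\mathbb Z$, with $A_nP_n=P_{n+1}A_n$ for all $n$; (2) $A_n|_{\operatorname{Ker}P_n}:\operatorname{Ker}P_n\to\operatorname{Ker}P_{n+1}$ is invertible for all $n$; (3) there exist $D,\lambda>0$ such that $\|\mathcal A(m,n)P_n\|\le D\nu_n(\mu_m/\mu_n)^{-\lambda}$ for $m\ge n$ and $\|\mathcal A(m,n)(\mathrm{Id}-P_n)\|\le D\nu_n(\mu_n/\mu_m)^{-\lambda}$ for $m\le n$, where for $m\le n$ one sets $\mathcal A(m,n):=(\mathcal A(n,m)|_{\operatorname{Ker}P_m})^{-1}:\operatorname{Ker}P_n\to\operatorname{Ker}P_m$. Weighted spaces: for $\beta\in\mathbb R$, $\ell^\infty_\beta$ is the Banach space of sequences $\mathbf x=(x_n)_{n\in\mathbb Z}\subset X$ with $\|\mathbf x\|_{\infty,\beta}:=\sup_{n\in\mathbb Z}\mu_n^\beta\|x_n\|<+\infty$,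 and $\ell^1_\beta$ is the Banach space of sequences with $\|\mathbf x\|_{1,\beta}:=\sum_{n\in\mathbb Z}\mu_n^\beta\nu_n\|x_n\|<+\infty$. Let $n_0\in\mathbb Z$ be the integer such that $\mu_n<1$ for $n<n_0$ and $\mu_n\ge1$ for $n\ge n_0$. Then $\ell^\infty_{\beta,|\cdot|}$ is the Banach space of sequences with $\|\mathbf x\|_{\infty,\beta,|\cdot|}:=\max\{\sup_{n<n_0}\mu_n^{|\beta|}\|x_n\|,\ \sup_{n\ge n_0}\mu_n^{-|\beta|}\|x_n\|\}<+\infty$, and $\ell^1_{\beta,|\cdot|}$ is the Banach space of sequences with $\|\mathbf x\|_{1,\beta,|\cdot|}:=\sum_{n<n_0}\mu_n^{|\beta|}\nu_n\|x_n\|+\sum_{n\ge n_0}\mu_n^{-|\beta|}\nu_n\|x_n\|<+\infty$. *)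

theory Defs
  imports "HOL-Analysis.Analysis"
begin

definition growth_rate :: "(int \<Rightarrow> real) \<Rightarrow> bool" where
  "growth_rate \<mu> \<longleftrightarrow> strict_mono \<mu> \<and> (\<forall>n. 0 < \<mu> n) \<and>
     filterlim \<mu> at_top at_top \<and> (\<mu> \<longlongrightarrow> 0) at_bot"

primrec evol_steps ::
  "(int \<Rightarrow> ('a::real_normed_vector \<Rightarrow>\<^sub>L 'a)) \<Rightarrow> int \<Rightarrow> nat \<Rightarrow> ('a \<Rightarrow>\<^sub>L 'a)" where
  "evol_steps A n 0 = id_blinfun"
| "evol_steps A n (Suc k) = A (n + int k) o\<^sub>L evol_steps A n k"

text \<open>\<open>evol A m n\<close> is the product \<open>A (m - 1) \<cdots> A n\<close>; it is meaningful only for \<open>m \<ge> n\<close>.\<close>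

definition evol ::
  "(int \<Rightarrow> ('a::real_normed_vector \<Rightarrow>\<^sub>L 'a)) \<Rightarrow> int \<Rightarrow> int \<Rightarrow> ('a \<Rightarrow>\<^sub>L 'a)" where
  "evol A m n = evol_steps A n (nat (m - n))"

definition Ker :: "('a::real_normed_vector \<Rightarrow>\<^sub>L 'a) \<Rightarrow> 'a set" where
  "Ker P = {x. blinfun_apply P x = 0}"

text \<open>For \<open>m \<le> n\<close>, the inverse \<open>Ker (P n) \<rightarrow> Ker (P m)\<close> of the restriction of
  \<open>evol A n m\<close> to \<open>Ker (P m)\<close>; its values outside \<open>Ker (P n)\<close> are irrelevant.\<close>

definition evol_back ::
  "(int \<Rightarrow> ('a::real_normed_vector \<Rightarrow>\<^sub>L 'a)) \<Rightarrow> (int \<Rightarrow> ('a \<Rightarrow>\<^sub>L 'a)) \<Rightarrow> int \<Rightarrow> int \<Rightarrow> 'a \<Rightarrow> 'a" where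
  "evol_back A P m n = inv_into (Ker (P m)) (blinfun_apply (evol A n m))"

text \<open>Since \<^const>\<open>onorm\<close> is meaningful only for bounded linear maps, boundedness of the backward
  operators is required explicitly along with the bound on their norm.\<close>

definition dichotomy ::
  "(int \<Rightarrow> real) \<Rightarrow> (int \<Rightarrow> real) \<Rightarrow> (int \<Rightarrow> ('a::real_normed_vector \<Rightarrow>\<^sub>L 'a)) \<Rightarrow> bool" where
  "dichotomy \<mu> \<nu> A \<longleftrightarrow>
     (\<exists>P :: int \<Rightarrow> ('a \<Rightarrow>\<^sub>L 'a).
        (\<forall>n. P n o\<^sub>L P n = P n) \<and>
        (\<forall>n. A n o\<^sub>L P n = P (n + 1) o\<^sub>L A n) \<and>
        (\<forall>n. bij_betw (blinfun_apply (A n)) (Ker (P n)) (Ker (P (n + 1)))) \<and>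
        (\<exists>D>0. \<exists>a>0.
           (\<forall>m n. n \<le> m \<longrightarrow>
              norm (evol A m n o\<^sub>L P n) \<le> D * \<nu> n * (\<mu> m / \<mu> n) powr (- a)) \<and>
           (\<forall>m n. m \<le> n \<longrightarrow>
              bounded_linear (\<lambda>x. evol_back A P m n (x - blinfun_apply (P n) x)) \<and>
              onorm (\<lambda>x. evol_back A P m n (x - blinfun_apply (P n) x))
                \<le> D * \<nu> n * (\<mu> n / \<mu> m) powr (- a))))"

definition linf_space :: "(int \<Rightarrow> real) \<Rightarrow> real \<Rightarrow> (int \<Rightarrow> 'a::real_normed_vector) set" where
  "linf_space \<mu> \<beta> = {x. bdd_above (range (\<lambda>n. \<mu> n powr \<beta> * norm (x n)))}"

definition l1_space ::
  "(int \<Rightarrow> real) \<Rightarrow> (int \<Rightarrow> real) \<Rightarrow> real \<Rightarrow> (int \<Rightarrow> 'a::real_normed_vector) set" where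
  "l1_space \<mu> \<nu> \<beta> = {x. (\<lambda>n. \<mu> n powr \<beta> * \<nu> n * norm (x n)) summable_on UNIV}"

definition unit_index :: "(int \<Rightarrow> real) \<Rightarrow> int" where
  "unit_index \<mu> = (THE n0. (\<forall>n<n0. \<mu> n < 1) \<and> (\<forall>n\<ge>n0. 1 \<le> \<mu> n))"

definition linf_abs_space :: "(int \<Rightarrow> real) \<Rightarrow> real \<Rightarrow> (int \<Rightarrow> 'a::real_normed_vector) set" where
  "linf_abs_space \<mu> \<beta> =
     {x. bdd_above ((\<lambda>n. \<mu> n powr \<bar>\<beta>\<bar> * norm (x n)) ` {..<unit_index \<mu>}) \<and>
         bdd_above ((\<lambda>n. \<mu> n powr (- \<bar>\<beta>\<bar>) * norm (x n)) ` {unit_index \<mu>..})}"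

definition l1_abs_space ::
  "(int \<Rightarrow> real) \<Rightarrow> (int \<Rightarrow> real) \<Rightarrow> real \<Rightarrow> (int \<Rightarrow> 'a::real_normed_vector) set" where
  "l1_abs_space \<mu> \<nu> \<beta> =
     {x. (\<lambda>n. \<mu> n powr \<bar>\<beta>\<bar> * \<nu> n * norm (x n)) summable_on {..<unit_index \<mu>} \<and>
         (\<lambda>n. \<mu> n powr (- \<bar>\<beta>\<bar>) * \<nu> n * norm (x n)) summable_on {unit_index \<mu>..}}"

end

theory Submission imports Defs begin

text \<open>
  The spaces with exponents \<open>\<beta>\<close> and \<open>-\<beta>\<close> both embed in the one with the two-sided weight, so by
  uniqueness there the responses to a point mass \<open>v\<close> at \<open>n\<close> obtained from the first two hypotheses
  coincide. This common response \<open>G n v\<close> therefore satisfies both weighted bounds. The projections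
  are \<open>P n v = G n v n\<close>; since \<open>G n v m = evol A m n (P n v)\<close> for \<open>m \<ge> n\<close> and
  \<open>G n v m = - evol_back A P m n (v - P n v)\<close> for \<open>m < n\<close>, the two bounds are the dichotomy estimates,
  with exponent \<open>\<beta>\<close>. That the bounds are uniform in \<open>n\<close> and \<open>v\<close> is a closed graph argument.
\<close>

section \<open>Boundedness of the solution map\<close>

text \<open>Zabreiko's lemma.\<close>

lemma countably_subadditive_seminorm_bounded:
  fixes q :: "'b::banach \<Rightarrow> real"
  assumes tri: "\<And>x y. q (x + y) \<le> q x + q y"
    and hom: "\<And>c x. q (c *\<^sub>R x) = \<bar>c\<bar> * q x"
    and count: "\<And>a b. summable (\<lambda>k. norm (a k)) \<Longrightarrow> summable b \<Longrightarrow> (\<And>k. q (a k) \<le> b k)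
                  \<Longrightarrow> q (suminf a) \<le> suminf b"
  shows "\<exists>C. \<forall>x. q x \<le> C * norm x"
proof -
  define V where "V N = {x. q x \<le> real N}" for N :: nat
  \<comment> \<open>Baire: the sublevel sets \<open>V N\<close> exhaust the space, so their closures
    cannot all have empty interior.\<close>
  have "\<exists>N. interior (closure (V N)) \<noteq> {}"
  proof (rule ccontr)
    assume "\<not> ?thesis"
    then have "euclidean interior_of \<Union>(range (\<lambda>N. closure (V N))) = ({} :: 'b set)"
      by (intro Baire_category_alt) (auto simp: completely_metrizable_space_euclidean)
    moreover have "x \<in> (\<Union>N. closure (V N))" for x
    proof -
      obtain N where "q x \<le> real N"
        using real_arch_simple by blast
      then show ?thesis
        using closure_subset[of "V N"] by (auto simp: V_def)
    qed
    then have "(\<Union>N. closure (V N)) = UNIV"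
      by blast
    ultimately show False
      by simp
  qed
  then obtain N x0 r where r: "r > 0" "ball x0 r \<subseteq> closure (V N)"
    by (metis all_not_in_conv mem_interior)
  \<comment> \<open>\<open>V N\<close> is symmetric and convex, and \<open>u\<close> is half of
    \<open>(x0 + u) - (x0 - u)\<close>, so the ball around \<open>x0\<close> can be moved to the
    origin.\<close>
  have sym: "u \<in> closure (V N)" if "norm u < r" for u
  proof (unfold closure_approachable, intro allI impI)
    fix e :: real assume "e > 0"
    have "x0 + u \<in> closure (V N)" "x0 - u \<in> closure (V N)"
      using that r by (auto simp: dist_norm norm_minus_commute intro!: subsetD[OF r(2)])
    then obtain a b where ab: "a \<in> V N" "dist a (x0 + u) < e" "b \<in> V N" "dist b (x0 - u) < e"
      using \<open>e > 0\<close> unfolding closure_approachable by blast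
    have "q ((1/2) *\<^sub>R a + (-1/2) *\<^sub>R b) \<le> (1/2) * q a + (1/2) * q b"
      using tri[of "(1/2) *\<^sub>R a" "(-1/2) *\<^sub>R b", unfolded hom] by simp
    then have "(1/2) *\<^sub>R a + (-1/2) *\<^sub>R b \<in> V N"
      using ab by (simp add: V_def)
    moreover have "(1/2) *\<^sub>R a + (-1/2) *\<^sub>R b - u = (1/2) *\<^sub>R ((a - (x0 + u)) - (b - (x0 - u)))"
      by (simp add: algebra_simps flip: scaleR_add_left)
    then have "dist ((1/2) *\<^sub>R a + (-1/2) *\<^sub>R b) u < e"
      using norm_triangle_ineq4[of "a - (x0 + u)" "b - (x0 - u)"] ab
      by (simp add: dist_norm)
    ultimately show "\<exists>y\<in>V N. dist y u < e"
      by blast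
  qed
  \<comment> \<open>Scaling \<open>x\<close> to norm \<open>r / 2\<close> brings it into this ball,
    where approximants have \<open>q\<close> at most \<open>N\<close>; scaling back multiplies by
    \<open>2 * norm x / r\<close>.\<close>
  define K where "K = 2 * real N / r"
  have "K \<ge> 0"
    using r by (simp add: K_def)
  have q0: "q 0 = 0"
    using hom[of 0 0] by simp
  have approx: "\<exists>a. q a \<le> K * norm x \<and> norm (x - a) \<le> norm x / 2" for x
  proof (cases "x = 0")
    case True
    then show ?thesis by (auto intro!: exI[of _ 0] simp: q0)
  next
    case False
    define t where "t = r / (2 * norm x)"
    have t: "t > 0"
      using False r by (simp add: t_def)
    have "norm (t *\<^sub>R x) < r"
      using False r by (simp add: t_def)
    from sym[OF this] obtain a where a: "a \<in> V N" "dist a (t *\<^sub>R x) < t * norm x / 2"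
      unfolding closure_approachable using t False by (metis mult_pos_pos half_gt_zero zero_less_norm_iff)
    have "q ((1/t) *\<^sub>R a) \<le> (1/t) * real N"
      using a t by (simp add: hom V_def divide_right_mono)
    also have "\<dots> = K * norm x"
      using r by (simp add: K_def t_def)
    finally have 1: "q ((1/t) *\<^sub>R a) \<le> K * norm x" .
    have "x - (1/t) *\<^sub>R a = (1/t) *\<^sub>R (t *\<^sub>R x - a)"
      using t by (simp add: algebra_simps)
    then have "norm (x - (1/t) *\<^sub>R a) = (1/t) * dist a (t *\<^sub>R x)"
      using t by (simp add: dist_norm norm_minus_commute)
    also have "\<dots> \<le> (1/t) * (t * norm x / 2)"
      using a(2) t by (intro mult_left_mono) auto
    also have "\<dots> = norm x / 2"
      using t by simp
    finally show ?thesis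
      using 1 by blast
  qed
  then obtain h where h: "\<And>x. q (h x) \<le> K * norm x" "\<And>x. norm (x - h x) \<le> norm x / 2"
    by metis
  have "q x \<le> 2 * K * norm x" for x
  proof -
    \<comment> \<open>\<open>z k\<close> is the remainder after \<open>k\<close> approximations. Its
      norm at least halves each time, so \<open>x\<close> is the sum of all \<open>h (z k)\<close>,
      and the geometric bounds on \<open>q (h (z k))\<close> add up to
      \<open>2 * K * norm x\<close>.\<close>
    define z where "z k = ((\<lambda>x. x - h x) ^^ k) x" for k
    have z_Suc: "z (Suc k) = z k - h (z k)" for k
      by (simp add: z_def)
    have z_le: "norm (z k) \<le> norm x * (1/2) ^ k" for k
    proof (induction k)
      case (Suc k)
      then show ?case
        using h(2)[of "z k"] by (simp add: z_Suc)
    qed (simp add: z_def)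
    have geo: "summable (\<lambda>k. c * (1/2) ^ k :: real)" for c
      by (intro summable_mult summable_geometric) simp
    have "z \<longlonglongrightarrow> 0"
      by (rule Lim_null_comparison[OF _ summable_LIMSEQ_zero[OF geo[of "norm x"]]]) (simp add: z_le)
    then have "(\<lambda>k. z k - z (Suc k)) sums (z 0 - 0)"
      by (rule telescope_sums')
    then have sums: "(\<lambda>k. h (z k)) sums x"
      by (simp add: z_Suc) (simp add: z_def)
    have "summable (\<lambda>k. norm (h (z k)))"
    proof (rule summable_comparison_test'[OF geo[of "2 * norm x"]])
      fix k
      have "norm (h (z k)) \<le> norm (z k) + norm (z k - h (z k))"
        by (metis norm_triangle_sub norm_minus_commute)
      also have "\<dots> \<le> 2 * norm (z k)"
        using h(2)[of "z k"] norm_ge_zero[of "z k"] by linarith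
      finally show "norm (norm (h (z k))) \<le> 2 * norm x * (1/2) ^ k"
        using z_le[of k] by simp
    qed
    moreover have "q (h (z k)) \<le> K * norm x * (1/2) ^ k" for k
      using h(1)[of "z k"] mult_left_mono[OF z_le \<open>K \<ge> 0\<close>, of k] by (simp add: mult.assoc)
    ultimately have "q (\<Sum>k. h (z k)) \<le> (\<Sum>k. K * norm x * (1/2) ^ k)"
      by (intro count geo)
    also have "\<dots> = 2 * K * norm x"
      using suminf_mult[OF summable_geometric[of "1/2::real"], of "K * norm x"]
      by (simp add: suminf_geometric)
    finally show ?thesis
      using sums_unique[OF sums] by simp
  qed
  then show ?thesis
    by blast
qed

section \<open>The difference equation and its solutions in weighted sup spaces\<close>

definition solves :: "(int \<Rightarrow> ('a::real_normed_vector \<Rightarrow>\<^sub>L 'a)) \<Rightarrow> (int \<Rightarrow> 'a) \<Rightarrow> (int \<Rightarrow> 'a) \<Rightarrow> bool" where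
  "solves A x y \<longleftrightarrow> (\<forall>n. x (n + 1) - blinfun_apply (A n) (x n) = y (n + 1))"

lemma solves_add: "solves A x y \<Longrightarrow> solves A x' y' \<Longrightarrow> solves A (\<lambda>n. x n + x' n) (\<lambda>n. y n + y' n)"
  by (simp add: solves_def blinfun.add_right algebra_simps)

lemma solves_scaleR: "solves A x y \<Longrightarrow> solves A (\<lambda>n. c *\<^sub>R x n) (\<lambda>n. c *\<^sub>R y n)"
  by (simp add: solves_def blinfun.scaleR_right flip: scaleR_diff_right)

lemma linf_space_iff: "x \<in> linf_space \<mu> \<gamma> \<longleftrightarrow> (\<exists>C. \<forall>n. \<mu> n powr \<gamma> * norm (x n) \<le> C)"
  by (auto simp: linf_space_def bdd_above_def)

lemma linf_space_add:
  assumes "x \<in> linf_space \<mu> \<gamma>" "x' \<in> linf_space \<mu> \<gamma>"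
  shows "(\<lambda>n. x n + x' n) \<in> linf_space \<mu> \<gamma>"
proof -
  obtain C C' where C: "\<And>n. \<mu> n powr \<gamma> * norm (x n) \<le> C" "\<And>n. \<mu> n powr \<gamma> * norm (x' n) \<le> C'"
    using assms by (auto simp: linf_space_iff)
  have "\<mu> n powr \<gamma> * norm (x n + x' n) \<le> C + C'" for n
    using mult_left_mono[OF norm_triangle_ineq[of "x n" "x' n"], of "\<mu> n powr \<gamma>"] C[of n]
    by (simp add: distrib_left)
  then show ?thesis
    unfolding linf_space_iff by blast
qed

lemma linf_space_scaleR:
  assumes "x \<in> linf_space \<mu> \<gamma>"
  shows "(\<lambda>n. c *\<^sub>R x n) \<in> linf_space \<mu> \<gamma>"
proof -
  obtain C where C: "\<And>n. \<mu> n powr \<gamma> * norm (x n) \<le> C"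
    using assms by (auto simp: linf_space_iff)
  have "\<mu> n powr \<gamma> * norm (c *\<^sub>R x n) \<le> \<bar>c\<bar> * C" for n
    using mult_left_mono[OF C[of n], of "\<bar>c\<bar>"] by (simp add: mult.left_commute)
  then show ?thesis
    unfolding linf_space_iff by blast
qed

text \<open>The weighted supremum of the solution is a seminorm in \<open>b\<close>. Along an
  absolutely convergent series whose solutions have summable bounds, the solutions can be summed
  termwise, and by uniqueness their sum is the solution for the sum; so Zabreiko's lemma applies.
  This is the closed graph argument, carried out without turning \<open>linf_space\<close> into a
  Banach space type.\<close>

lemma bounded_solution_map:
  fixes A :: "int \<Rightarrow> ('a::banach \<Rightarrow>\<^sub>L 'a)" and L :: "'b::banach \<Rightarrow> int \<Rightarrow> 'a"
  assumes pos: "\<And>n. 0 < \<mu> n"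
    and L: "\<And>n. bounded_linear (\<lambda>b. L b n)"
    and ex: "\<And>b. \<exists>!x. x \<in> linf_space \<mu> \<gamma> \<and> solves A x (L b)"
  shows "\<exists>C. \<forall>b x. x \<in> linf_space \<mu> \<gamma> \<longrightarrow> solves A x (L b) \<longrightarrow>
           (\<forall>n. \<mu> n powr \<gamma> * norm (x n) \<le> C * norm b)"
proof -
  define T where "T b = (THE x. x \<in> linf_space \<mu> \<gamma> \<and> solves A x (L b))" for b
  have T: "T b \<in> linf_space \<mu> \<gamma>" "solves A (T b) (L b)" for b
    using theI'[OF ex[of b]] by (auto simp: T_def)
  have T_eq: "T b = x" if "x \<in> linf_space \<mu> \<gamma>" "solves A x (L b)" for b x
    using ex[of b] T[of b] that by blast
  define q where "q b = (SUP n. \<mu> n powr \<gamma> * norm (T b n))" for b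
  have q_ge: "\<mu> n powr \<gamma> * norm (T b n) \<le> q b" for b n
    unfolding q_def using T(1)[of b] by (intro cSUP_upper) (auto simp: linf_space_def)
  have q_le: "q b \<le> c" if "\<And>n. \<mu> n powr \<gamma> * norm (T b n) \<le> c" for b c
    unfolding q_def using that by (intro cSUP_least) auto
  have L_add: "L (b + b') = (\<lambda>n. L b n + L b' n)" and L_scale: "L (c *\<^sub>R b) = (\<lambda>n. c *\<^sub>R L b n)" for b b' c
    using linear_add[OF bounded_linear.linear[OF L]] linear_scale[OF bounded_linear.linear[OF L]]
    by auto
  have T_add: "T (b + b') = (\<lambda>n. T b n + T b' n)" for b b'
    by (intro T_eq linf_space_add T) (simp add: L_add solves_add T)
  have T_scale: "T (c *\<^sub>R b) = (\<lambda>n. c *\<^sub>R T b n)" for b c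
    by (intro T_eq linf_space_scaleR T) (simp add: L_scale solves_scaleR T)
  have "\<exists>C. \<forall>b. q b \<le> C * norm b"
  proof (rule countably_subadditive_seminorm_bounded)
    fix b b'
    show "q (b + b') \<le> q b + q b'"
    proof (rule q_le)
      fix n
      show "\<mu> n powr \<gamma> * norm (T (b + b') n) \<le> q b + q b'"
        using mult_left_mono[OF norm_triangle_ineq[of "T b n" "T b' n"], of "\<mu> n powr \<gamma>"]
          q_ge[of n b] q_ge[of n b'] by (simp add: distrib_left T_add)
    qed
  next
    have le: "q (c *\<^sub>R b) \<le> \<bar>c\<bar> * q b" for c b
    proof (rule q_le)
      fix n
      show "\<mu> n powr \<gamma> * norm (T (c *\<^sub>R b) n) \<le> \<bar>c\<bar> * q b"
        using mult_left_mono[OF q_ge[of n b], of "\<bar>c\<bar>"] by (simp add: T_scale mult.left_commute)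
    qed
    fix c b
    show "q (c *\<^sub>R b) = \<bar>c\<bar> * q b"
    proof (cases "c = 0")
      case True
      then show ?thesis
        by (simp add: q_def T_scale[of 0, simplified])
    next
      case False
      \<comment> \<open>The reverse inequality is \<open>le\<close> itself, applied with the factor
        \<open>1/c\<close>.\<close>
      have "\<bar>c\<bar> * q ((1/c) *\<^sub>R (c *\<^sub>R b)) \<le> \<bar>c\<bar> * (\<bar>1/c\<bar> * q (c *\<^sub>R b))"
        by (intro mult_left_mono le) auto
      then have "\<bar>c\<bar> * q b \<le> q (c *\<^sub>R b)"
        using False by simp
      with le[of c b] show ?thesis
        by simp
    qed
  next
    fix a :: "nat \<Rightarrow> 'b" and s
    assume a: "summable (\<lambda>k. norm (a k))" and s: "summable s" and q_s: "\<And>k. q (a k) \<le> s k"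
    \<comment> \<open>The bounds \<open>s k\<close> make the series of solutions converge absolutely
      at each index and pass to its sum; the equation survives because each \<open>A n\<close> is
      continuous.\<close>
    define X where "X n = (\<Sum>k. T (a k) n)" for n
    have bd: "\<mu> n powr \<gamma> * norm (T (a k) n) \<le> s k" for n k
      using q_ge q_s order_trans by blast
    have sum: "summable (\<lambda>k. norm (T (a k) n))" for n
    proof (rule summable_comparison_test'[OF summable_divide[OF s, of "\<mu> n powr \<gamma>"]])
      fix k
      show "norm (norm (T (a k) n)) \<le> s k / \<mu> n powr \<gamma>"
        using bd[of n k] pos[of n] by (simp add: field_simps)
    qed
    have X_le: "\<mu> n powr \<gamma> * norm (X n) \<le> suminf s" for n
    proof -
      have "\<mu> n powr \<gamma> * norm (X n) \<le> \<mu> n powr \<gamma> * (\<Sum>k. norm (T (a k) n))"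
        unfolding X_def by (intro mult_left_mono summable_norm sum) simp
      also have "\<dots> = (\<Sum>k. \<mu> n powr \<gamma> * norm (T (a k) n))"
        by (intro suminf_mult[symmetric] sum)
      also have "\<dots> \<le> suminf s"
        by (intro suminf_le bd s summable_mult sum)
      finally show ?thesis .
    qed
    have "T (suminf a) = X"
    proof (rule T_eq)
      show "X \<in> linf_space \<mu> \<gamma>"
        using X_le unfolding linf_space_iff by blast
      show "solves A X (L (suminf a))"
        unfolding solves_def
      proof
        fix n
        have summ: "summable (\<lambda>k. T (a k) m)" for m
          by (rule summable_norm_cancel[OF sum])
        have "X (n + 1) - A n (X n) = (\<Sum>k. T (a k) (n + 1)) - (\<Sum>k. A n (T (a k) n))"
          unfolding X_def by (simp add: bounded_linear.suminf[OF blinfun.bounded_linear_right summ])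
        also have "\<dots> = (\<Sum>k. T (a k) (n + 1) - A n (T (a k) n))"
          by (intro suminf_diff summ bounded_linear.summable[OF blinfun.bounded_linear_right summ])
        also have "\<dots> = (\<Sum>k. L (a k) (n + 1))"
          using T(2) by (simp add: solves_def)
        also have "\<dots> = L (suminf a) (n + 1)"
          by (rule bounded_linear.suminf[OF L summable_norm_cancel[OF a], symmetric])
        finally show "X (n + 1) - A n (X n) = L (suminf a) (n + 1)" .
      qed
    qed
    then show "q (suminf a) \<le> suminf s"
      using X_le by (intro q_le) simp
  qed
  then obtain C where "\<And>b. q b \<le> C * norm b"
    by blast
  then show ?thesis
    using T_eq q_ge order_trans by metis
qed

text \<open>This lets \<open>real \<Rightarrow>\<^sub>C real\<close> serve as the Banach parameter
  space of \<open>bounded_solution_map\<close>.\<close>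

instance bcontfun :: (metric_space, banach) banach ..

section \<open>Responses to point masses\<close>

definition impulse :: "int \<Rightarrow> 'a::real_normed_vector \<Rightarrow> int \<Rightarrow> 'a" where
  "impulse n v = (\<lambda>m. if m = n then v else 0)"

lemma impulse_summable_on:
  fixes w :: "int \<Rightarrow> real"
  shows "(\<lambda>m. w m * norm (impulse n v m)) summable_on S"
proof (rule finite_nonzero_values_imp_summable_on)
  show "finite {m \<in> S. w m * norm (impulse n v m) \<noteq> 0}"
    by (rule finite_subset[of _ "{n}"]) (auto simp: impulse_def)
qed

text \<open>
  If no uniform constant existed, impulses violating the bound by \<open>4 ^ k\<close> could be combined with weights
  \<open>a k / 2 ^ k\<close> into a bounded map from bounded sequences \<open>a\<close> to \<open>\<ell>\<^sup>1\<close>, whose solution map would be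
  unbounded. Since \<open>nat\<close> is not an instance of \<open>metric_space\<close>, bounded sequences are represented by
  bounded continuous functions on the reals sampled at the naturals.
\<close>

lemma impulse_bound:
  fixes A :: "int \<Rightarrow> ('a::banach \<Rightarrow>\<^sub>L 'a)"
  assumes pos: "\<And>n. 0 < \<mu> n" and nu: "\<And>n. 0 < \<nu> n"
    and ex: "\<And>y. y \<in> l1_space \<mu> \<nu> \<gamma> \<Longrightarrow> \<exists>!x. x \<in> linf_space \<mu> \<gamma> \<and> solves A x y"
  shows "\<exists>K>0. \<forall>n v x. x \<in> linf_space \<mu> \<gamma> \<longrightarrow> solves A x (impulse n v) \<longrightarrow>
           (\<forall>m. \<mu> m powr \<gamma> * norm (x m) \<le> K * (\<mu> n powr \<gamma> * \<nu> n * norm v))"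
proof (rule ccontr)
  assume neg: "\<not> ?thesis"
  define w where "w n = \<mu> n powr \<gamma> * \<nu> n" for n
  have w: "w n > 0" for n
    using pos[of n] nu[of n] by (simp add: w_def)
  have "\<forall>k::nat. \<exists>n v x m. x \<in> linf_space \<mu> \<gamma> \<and> solves A x (impulse n v) \<and>
           4 ^ k * (w n * norm v) < \<mu> m powr \<gamma> * norm (x m)"
  proof
    fix k :: nat
    have "(4::real) ^ k > 0"
      by simp
    with neg have "\<not> (\<forall>n v x. x \<in> linf_space \<mu> \<gamma> \<longrightarrow> solves A x (impulse n v) \<longrightarrow>
        (\<forall>m. \<mu> m powr \<gamma> * norm (x m) \<le> 4 ^ k * (\<mu> n powr \<gamma> * \<nu> n * norm v)))"
      by blast
    then show "\<exists>n v x m. x \<in> linf_space \<mu> \<gamma> \<and> solves A x (impulse n v) \<and>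
        4 ^ k * (w n * norm v) < \<mu> m powr \<gamma> * norm (x m)"
      by (simp add: w_def not_le)
  qed
  then obtain n v x m where x: "\<And>k::nat. x k \<in> linf_space \<mu> \<gamma>" "\<And>k. solves A (x k) (impulse (n k) (v k))"
    and big: "\<And>k. 4 ^ k * (w (n k) * norm (v k)) < \<mu> (m k) powr \<gamma> * norm (x k (m k))"
    by metis
  \<comment> \<open>A zero impulse has only the zero solution, which cannot violate the bound. Hence
    \<open>c k\<close> below is positive and may be divided by.\<close>
  have v0: "v k \<noteq> 0" for k
  proof
    assume "v k = 0"
    then have y: "impulse (n k) (v k) = (\<lambda>_. 0)"
      by (auto simp: impulse_def)
    have "(\<lambda>_. 0) \<in> l1_space \<mu> \<nu> \<gamma>"
      by (simp add: l1_space_def)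
    moreover have "(\<lambda>_. 0) \<in> linf_space \<mu> \<gamma>" "solves A (\<lambda>_. 0) (\<lambda>_. 0)"
      by (auto simp: linf_space_iff solves_def blinfun.zero_right)
    ultimately have "x k = (\<lambda>_. 0)"
      using ex x(1)[of k] x(2)[of k, unfolded y] by blast
    then show False
      using big[of k] \<open>v k = 0\<close> by simp
  qed
  define c where "c k = w (n k) * norm (v k)" for k
  have c: "c k > 0" for k
    using v0 w by (simp add: c_def)
  define u where "u k = (1 / c k) *\<^sub>R v k" for k
  have u: "w (n k) * norm (u k) = 1" for k
    using v0[of k] w[of "n k"] by (simp add: u_def c_def)
  \<comment> \<open>\<open>impulse (n k) (u k)\<close> has weighted l1 norm 1, so these terms are
    summable in l1 and \<open>L a\<close> is their superposition.\<close>
  define t where "t a k j = (apply_bcontfun a (real k) * (1/2) ^ k) *\<^sub>R impulse (n k) (u k) j"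
    for a :: "real \<Rightarrow>\<^sub>C real" and k j
  define L where "L a j = (\<Sum>k. t a k j)" for a j
  have t_le: "w j * norm (t a k j) \<le> norm a * (1/2) ^ k * (if n k = j then 1 else 0)" for a k j
  proof (cases "n k = j")
    case True
    have "\<bar>apply_bcontfun a (real k)\<bar> \<le> norm a"
      using norm_bounded[of a "real k"] by simp
    have "w j * norm (t a k j) = \<bar>apply_bcontfun a (real k)\<bar> * (1/2) ^ k * (w (n k) * norm (u k))"
      using True by (simp add: t_def impulse_def abs_mult)
    also have "\<dots> = \<bar>apply_bcontfun a (real k)\<bar> * (1/2) ^ k"
      by (simp only: u mult_1_right)
    finally show ?thesis
      using True \<open>\<bar>apply_bcontfun a (real k)\<bar> \<le> norm a\<close> by simp
  qed (simp add: t_def impulse_def)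
  have geo: "summable (\<lambda>k. s * (1/2) ^ k :: real)" "(\<Sum>k. s * (1/2) ^ k :: real) = 2 * s" for s
    using suminf_mult[OF summable_geometric[of "1/2::real"], of s]
    by (auto simp: suminf_geometric intro!: summable_mult summable_geometric)
  have sum_i: "summable (\<lambda>k. s * (1/2) ^ k * (if n k = j then 1 else 0) :: real)" if "s \<ge> 0" for s j
    by (rule summable_comparison_test'[OF geo(1)[of s]]) (use that in auto)
  have sum_t: "summable (\<lambda>k. norm (t a k j))" for a j
  proof (rule summable_comparison_test'[OF summable_divide[OF sum_i[of "norm a" j], of "w j"]])
    show "norm (norm (t a k j)) \<le> norm a * (1/2) ^ k * (if n k = j then 1 else 0) / w j" for k
      using t_le[of j a k] w[of j] by (simp add: field_simps)
  qed simp
  have L_le: "w j * norm (L a j) \<le> (\<Sum>k. norm a * (1/2) ^ k * (if n k = j then 1 else 0))" for a j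
  proof -
    have "w j * norm (L a j) \<le> w j * (\<Sum>k. norm (t a k j))"
      unfolding L_def using w[of j] by (intro mult_left_mono summable_norm sum_t) simp
    also have "\<dots> = (\<Sum>k. w j * norm (t a k j))"
      by (intro suminf_mult[symmetric] sum_t)
    also have "\<dots> \<le> (\<Sum>k. norm a * (1/2) ^ k * (if n k = j then 1 else 0))"
      by (intro suminf_le t_le summable_mult sum_t sum_i) simp
    finally show ?thesis .
  qed
  \<comment> \<open>Each \<open>k\<close> contributes to at most one \<open>j\<close>, namely
    \<open>n k\<close>, so after exchanging the sums the inner sum over \<open>F\<close> is at most
    \<open>norm a / 2 ^ k\<close>. The bound places \<open>L a\<close> in \<open>l1_space\<close>
    and, for a singleton \<open>F\<close>, bounds each coordinate of \<open>L\<close>.\<close>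
  have L_sum_le: "(\<Sum>j\<in>F. w j * norm (L a j)) \<le> 2 * norm a" if "finite F" for a F
  proof -
    have "(\<Sum>j\<in>F. w j * norm (L a j)) \<le> (\<Sum>j\<in>F. \<Sum>k. norm a * (1/2) ^ k * (if n k = j then 1 else 0))"
      by (intro sum_mono L_le)
    also have "\<dots> = (\<Sum>k. \<Sum>j\<in>F. norm a * (1/2) ^ k * (if n k = j then 1 else 0))"
      by (intro suminf_sum[symmetric] sum_i) simp
    also have "\<dots> \<le> (\<Sum>k. norm a * (1/2) ^ k)"
      using that by (intro suminf_le geo summable_sum sum_i) (auto simp flip: sum_distrib_left)
    finally show ?thesis
      by (simp add: geo)
  qed
  have "L a \<in> l1_space \<mu> \<nu> \<gamma>" for a
    unfolding l1_space_def mem_Collect_eq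
  proof (rule nonneg_bdd_above_summable_on)
    show "bdd_above (sum (\<lambda>n. \<mu> n powr \<gamma> * \<nu> n * norm (L a n)) ` {F. F \<subseteq> UNIV \<and> finite F})"
      using L_sum_le[of _ a] by (auto simp: bdd_above_def w_def)
  qed (use pos nu in \<open>simp add: less_imp_le\<close>)
  then have ex_L: "\<exists>!x. x \<in> linf_space \<mu> \<gamma> \<and> solves A x (L a)" for a
    by (rule ex)
  have bl: "bounded_linear (\<lambda>a. L a j)" for j
  proof (rule bounded_linear_intro)
    have summ: "summable (\<lambda>k. t a k j)" for a
      by (rule summable_norm_cancel[OF sum_t])
    show "L (a + b) j = L a j + L b j" for a b
      unfolding L_def by (subst suminf_add[OF summ summ]) (simp add: t_def algebra_simps)
    show "L (r *\<^sub>R a) j = r *\<^sub>R L a j" for r a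
      unfolding L_def by (subst suminf_scaleR_right[OF summ]) (simp add: t_def mult.assoc)
    show "norm (L a j) \<le> norm a * (2 / w j)" for a
      using L_sum_le[of "{j}" a] w[of j] by (simp add: field_simps)
  qed
  obtain C where C: "\<And>a x m. x \<in> linf_space \<mu> \<gamma> \<Longrightarrow> solves A x (L a) \<Longrightarrow>
      \<mu> m powr \<gamma> * norm (x m) \<le> C * norm a"
    using bounded_solution_map[where L = L, OF pos bl ex_L] by blast
  have "2 ^ k \<le> \<bar>C\<bar>" for k
  proof -
    \<comment> \<open>A tent of half-width 1 centred at \<open>k\<close> vanishes at every other
      natural number, so \<open>L e\<close> is a multiple of the \<open>k\<close>-th impulse
      alone.\<close>
    have "(\<lambda>s. max 0 (1 - \<bar>s - real k\<bar>)) \<in> bcontfun"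
      by (rule bcontfun_normI[where b = 1]) (auto intro!: continuous_intros)
    then obtain e where tent: "apply_bcontfun e = (\<lambda>s. max 0 (1 - \<bar>s - real k\<bar>))"
      by (metis bcontfunE)
    have e: "apply_bcontfun e (real i) = (if i = k then 1 else 0)" for i
      by (auto simp: tent)
    have "norm e \<le> 1"
      by (rule norm_bound) (simp add: tent)
    have "L e j = ((1/2) ^ k / c k) *\<^sub>R impulse (n k) (v k) j" for j
    proof -
      have "L e j = (\<Sum>i\<in>{k}. t e i j)"
        unfolding L_def by (rule suminf_finite) (auto simp: t_def e)
      then show ?thesis
        by (simp add: t_def e u_def impulse_def)
    qed
    then have "L e = (\<lambda>j. ((1/2) ^ k / c k) *\<^sub>R impulse (n k) (v k) j)"
      by auto
    \<comment> \<open>The scaled \<open>x k\<close> solves the equation for \<open>L e\<close>. Its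
      weighted value at \<open>m k\<close> exceeds \<open>4 ^ k * c k\<close> before scaling by
      \<open>(1/2) ^ k / c k\<close>, which leaves \<open>2 ^ k\<close>.\<close>
    then have "\<mu> (m k) powr \<gamma> * norm (((1/2) ^ k / c k) *\<^sub>R x k (m k)) \<le> C * norm e"
      by (intro C linf_space_scaleR x) (simp add: solves_scaleR x)
    then have "(1/2) ^ k / c k * (\<mu> (m k) powr \<gamma> * norm (x k (m k))) \<le> C * norm e"
      using c[of k] by (simp add: mult.left_commute)
    moreover have "(1/2) ^ k / c k * (4 ^ k * c k) \<le> (1/2) ^ k / c k * (\<mu> (m k) powr \<gamma> * norm (x k (m k)))"
      using big[of k] c[of k] by (intro mult_left_mono) (auto simp: c_def)
    moreover have "(1/2) ^ k / c k * (4 ^ k * c k) = (2::real) ^ k"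
      using c[of k] by (simp flip: power_mult_distrib)
    moreover have "C * norm e \<le> \<bar>C\<bar> * 1"
      using \<open>norm e \<le> 1\<close> by (intro mult_mono) auto
    ultimately show ?thesis
      by linarith
  qed
  moreover obtain k where "\<bar>C\<bar> < 2 ^ k"
    using real_arch_pow[of 2 "\<bar>C\<bar>"] by auto
  ultimately show False
    using not_le by blast
qed

section \<open>From the Green function to the dichotomy\<close>

lemma evol_refl: "evol A n n = id_blinfun"
  by (simp add: evol_def)

lemma evol_add_one: "n \<le> m \<Longrightarrow> evol A (m + 1) n = A m o\<^sub>L evol A m n"
proof -
  assume "n \<le> m"
  then have "nat (m + 1 - n) = Suc (nat (m - n))"
    by linarith
  with \<open>n \<le> m\<close> show ?thesis
    by (simp add: evol_def)
qed

lemma evol_orbit: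
  fixes A :: "int \<Rightarrow> ('a::real_normed_vector \<Rightarrow>\<^sub>L 'a)"
  assumes "n \<le> m" "\<And>k. n \<le> k \<Longrightarrow> k < m \<Longrightarrow> x (k + 1) = A k (x k)"
  shows "evol A m n (x n) = x m"
  using assms
proof (induction m rule: int_ge_induct)
  case (step m)
  then show ?case
    by (simp add: evol_add_one)
qed (simp add: evol_refl)

lemma evol_bij_betw:
  assumes "n \<le> m" "\<And>k. bij_betw (blinfun_apply (A k)) (V k) (V (k + 1))"
  shows "bij_betw (blinfun_apply (evol A m n)) (V n) (V m)"
  using assms(1)
proof (induction m rule: int_ge_induct)
  case (step m)
  have "blinfun_apply (evol A (m + 1) n) = blinfun_apply (A m) \<circ> blinfun_apply (evol A m n)"
    using step by (auto simp: evol_add_one)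
  then show ?case
    using bij_betw_trans[OF step.IH assms(2)] by (simp only:)
qed (simp add: evol_refl bij_betw_def inj_on_def)

text \<open>\<open>S\<close> stands for a space in which solutions are unique. Identities for
  \<open>G\<close> come from exhibiting a second solution in \<open>S\<close> for the same impulse,
  hence the closure conditions; \<open>S_restrict\<close> permits cutting a solution off at a given
  time.\<close>

locale green_function =
  fixes A :: "int \<Rightarrow> ('a::real_normed_vector \<Rightarrow>\<^sub>L 'a)"
    and S :: "(int \<Rightarrow> 'a) set"
    and G :: "int \<Rightarrow> 'a \<Rightarrow> int \<Rightarrow> 'a"
  assumes S_add: "\<And>x y. x \<in> S \<Longrightarrow> y \<in> S \<Longrightarrow> (\<lambda>m. x m + y m) \<in> S"
    and S_scaleR: "\<And>c x. x \<in> S \<Longrightarrow> (\<lambda>m. c *\<^sub>R x m) \<in> S"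
    and S_impulse: "\<And>n v. impulse n v \<in> S"
    and S_restrict: "\<And>x J. x \<in> S \<Longrightarrow> (\<lambda>m. if m \<in> J then x m else 0) \<in> S"
    and S_unique: "\<And>x x' y. x \<in> S \<Longrightarrow> x' \<in> S \<Longrightarrow> solves A x y \<Longrightarrow> solves A x' y \<Longrightarrow> x = x'"
    and G_in: "\<And>n v. G n v \<in> S"
    and G_solves: "\<And>n v. solves A (G n v) (impulse n v)"
begin

lemma G_eqI: "x \<in> S \<Longrightarrow> solves A x (impulse n v) \<Longrightarrow> G n v = x"
  using S_unique G_in G_solves by blast

lemma G_add: "G n (v + v') m = G n v m + G n v' m"
proof -
  have "impulse n (v + v') = (\<lambda>m. impulse n v m + impulse n v' m)"
    by (auto simp: impulse_def)
  then have "G n (v + v') = (\<lambda>m. G n v m + G n v' m)"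
    by (intro G_eqI S_add G_in) (simp add: solves_add G_solves)
  then show ?thesis by simp
qed

lemma G_scaleR: "G n (c *\<^sub>R v) m = c *\<^sub>R G n v m"
proof -
  have "impulse n (c *\<^sub>R v) = (\<lambda>m. c *\<^sub>R impulse n v m)"
    by (auto simp: impulse_def)
  then have "G n (c *\<^sub>R v) = (\<lambda>m. c *\<^sub>R G n v m)"
    by (intro G_eqI S_scaleR G_in) (simp add: solves_scaleR G_solves)
  then show ?thesis by simp
qed

lemma G_step: "m + 1 \<noteq> n \<Longrightarrow> G n v (m + 1) = A m (G n v m)"
  using G_solves[of n v, unfolded solves_def, rule_format, of m] by (simp add: impulse_def)

lemma G_jump: "G n v n = A (n - 1) (G n v (n - 1)) + v"
  using G_solves[of n v, unfolded solves_def, rule_format, of "n - 1"]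
  by (simp add: impulse_def algebra_simps)

text \<open>Setting \<open>G n v\<close> to zero before time \<open>n\<close> removes the incoming
  term, so the jump at \<open>n\<close> becomes the full value \<open>G n v n\<close>.\<close>

lemma G_diag_idem: "G n (G n v n) n = G n v n"
proof -
  have "solves A (\<lambda>m. if m \<in> {n..} then G n v m else 0) (impulse n (G n v n))"
    unfolding solves_def impulse_def using G_step[of _ n v] by (auto simp: blinfun.zero_right)
  then have "G n (G n v n) = (\<lambda>m. if m \<in> {n..} then G n v m else 0)"
    by (intro G_eqI S_restrict G_in)
  then show ?thesis by simp
qed

text \<open>Keeping only the part of \<open>G n v\<close> before \<open>k\<close>, with opposite
  sign, leaves a single jump \<open>G n v k\<close> at \<open>k\<close> and the value zero there.
  Thus the past values of \<open>G n v\<close> lie in the kernels of the projections.\<close>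

lemma G_diag_past: "k < n \<Longrightarrow> G k (G n v k) k = 0"
proof -
  assume k: "k < n"
  have "solves A (\<lambda>m. (-1) *\<^sub>R (if m \<in> {..<k} then G n v m else 0)) (impulse k (G n v k))"
    unfolding solves_def
  proof
    fix m
    have "G n v (m + 1) = A m (G n v m)" if "m < k"
      using that k by (intro G_step) simp
    then show "(- 1) *\<^sub>R (if m + 1 \<in> {..<k} then G n v (m + 1) else 0) -
         A m ((- 1) *\<^sub>R (if m \<in> {..<k} then G n v m else 0)) = impulse k (G n v k) (m + 1)"
      by (auto simp: blinfun.zero_right blinfun.minus_right impulse_def)
  qed
  then have "G k (G n v k) = (\<lambda>m. (-1) *\<^sub>R (if m \<in> {..<k} then G n v m else 0))"
    by (intro G_eqI S_scaleR S_restrict G_in)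
  then show ?thesis by simp
qed

text \<open>Subtracting \<open>v\<close> at time \<open>n\<close> cancels the jump there and defers
  it by one step, as \<open>A n v\<close>. At \<open>m = n + 1\<close> this yields the commutation
  of the projections with \<open>A\<close>, at \<open>m = n\<close> the injectivity of
  \<open>A n\<close> on the kernel.\<close>

lemma G_shift: "G (n + 1) (A n v) m = G n v m - impulse n v m"
proof -
  have "solves A (\<lambda>m. G n v m + impulse n (- v) m) (impulse (n + 1) (A n v))"
    unfolding solves_def
  proof
    fix m
    consider "m = n" | "m + 1 = n" | "m \<noteq> n" "m + 1 \<noteq> n" by blast
    then show "G n v (m + 1) + impulse n (- v) (m + 1) - A m (G n v m + impulse n (- v) m) =
        impulse (n + 1) (A n v) (m + 1)"
    proof cases
      case 2
      then have "m = n - 1" by simp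
      then show ?thesis
        using G_jump[of n v] by (simp add: impulse_def)
    qed (use G_step[of m n v] in
        \<open>simp_all add: impulse_def blinfun.add_right blinfun.minus_right blinfun.diff_right\<close>)
  qed
  then have "G (n + 1) (A n v) = (\<lambda>m. G n v m + impulse n (- v) m)"
    by (intro G_eqI S_add S_impulse G_in)
  then show ?thesis
    by (simp add: impulse_def)
qed

lemma dichotomy_if_bounded:
  assumes pos: "\<And>n. 0 < \<mu> n" and nu: "\<And>n. 1 \<le> \<nu> n" and "0 < K" "0 < \<beta>"
    and fwd: "\<And>n v m. norm (G n v m) \<le> K * \<nu> n * (\<mu> m / \<mu> n) powr (- \<beta>) * norm v"
    and bwd: "\<And>n v m. norm (G n v m) \<le> K * \<nu> n * (\<mu> n / \<mu> m) powr (- \<beta>) * norm v"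
  shows "dichotomy \<mu> \<nu> A"
proof -
  define P where "P n = Blinfun (\<lambda>v. G n v n)" for n
  have G_bl: "bounded_linear (\<lambda>v. G n v m)" for n m
    by (rule bounded_linear_intro[OF G_add G_scaleR, of _ _ "K * \<nu> n * (\<mu> m / \<mu> n) powr (- \<beta>)"])
      (use fwd in \<open>simp add: mult.commute\<close>)
  then have P: "P n v = G n v n" for n v
    by (simp add: P_def bounded_linear_Blinfun_apply)
  have PP: "P n (P n v) = P n v" for n v
    by (simp add: P G_diag_idem)
  have P_idem: "P n o\<^sub>L P n = P n" for n
    by (rule blinfun_eqI) (simp add: PP)
  have P_comm: "P (n + 1) (A n v) = A n (P n v)" for n v
    using G_shift[of n v "n + 1"] G_step[of n n v] by (simp add: P impulse_def)
  \<comment> \<open>On the kernel, \<open>G_shift\<close> recovers \<open>a\<close> from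
    \<open>A n a\<close> as \<open>- G (n + 1) (A n a) n\<close>. By \<open>G_jump\<close> the same
    formula produces a preimage of \<open>w\<close>.\<close>
  have bij: "bij_betw (blinfun_apply (A n)) (Ker (P n)) (Ker (P (n + 1)))" for n
  proof (rule bij_betw_imageI)
    show "inj_on (blinfun_apply (A n)) (Ker (P n))"
    proof (rule inj_onI)
      fix a b assume ab: "a \<in> Ker (P n)" "b \<in> Ker (P n)" "A n a = A n b"
      then have "G n a n = 0" "G n b n = 0"
        by (auto simp: Ker_def P)
      then have "G (n + 1) (A n a) n = - a" "G (n + 1) (A n b) n = - b"
        by (simp_all add: G_shift impulse_def)
      then show "a = b"
        using ab(3) by (metis neg_equal_iff_equal)
    qed
    have "w \<in> blinfun_apply (A n) ` Ker (P n)" if "w \<in> Ker (P (n + 1))" for w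
    proof (rule image_eqI)
      have "G (n + 1) w (n + 1) = 0"
        using that by (simp add: Ker_def P)
      then have "A n (G (n + 1) w n) + w = 0"
        using G_jump[of "n + 1" w] by simp
      then show "w = A n (- G (n + 1) w n)"
        by (simp add: blinfun.minus_right eq_neg_iff_add_eq_0 add.commute)
      show "- G (n + 1) w n \<in> Ker (P n)"
        using G_diag_past[of n "n + 1" w] by (simp add: Ker_def blinfun.minus_right) (simp add: P)
    qed
    moreover have "A n v \<in> Ker (P (n + 1))" if "v \<in> Ker (P n)" for v
      using that by (simp add: Ker_def P_comm blinfun.zero_right)
    ultimately show "blinfun_apply (A n) ` Ker (P n) = Ker (P (n + 1))"
      by blast
  qed
  have back_eq: "evol_back A P m n (v - P n v) = impulse n v m - G n v m" if "m \<le> n" for m n v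
  proof -
    \<comment> \<open>\<open>x\<close> equals \<open>- G n v\<close> before \<open>n\<close> and
      \<open>v - P n v\<close> at \<open>n\<close>. Subtracting from the impulse absorbs the jump,
      so \<open>x\<close> is an orbit from \<open>m\<close> to \<open>n\<close> that starts in
      \<open>Ker (P m)\<close>.\<close>
    define x where "x k = impulse n v k - G n v k" for k
    have "evol A n m (x m) = x n"
    proof (rule evol_orbit[OF that])
      fix k assume "m \<le> k" "k < n"
      then show "x (k + 1) = A k (x k)"
        using G_step[of k n v] G_jump[of n v]
        by (cases "k + 1 = n") (auto simp: x_def impulse_def blinfun.minus_right)
    qed
    moreover have "x m \<in> Ker (P m)"
    proof (cases "m = n")
      case True
      then have "x m = v - P n v"
        by (simp add: x_def impulse_def P)
      then show ?thesis
        using True by (simp add: Ker_def blinfun.diff_right PP)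
    next
      case False
      then show ?thesis
        using that G_diag_past[of m n v]
        by (simp add: Ker_def x_def impulse_def blinfun.minus_right) (simp add: P)
    qed
    moreover have "inj_on (blinfun_apply (evol A n m)) (Ker (P m))"
      using evol_bij_betw[OF that, of A "\<lambda>k. Ker (P k)"] bij by (auto simp: bij_betw_def)
    ultimately have "evol_back A P m n (x n) = x m"
      unfolding evol_back_def by (metis inv_into_f_f)
    then show ?thesis
      by (simp add: x_def impulse_def P)
  qed
  have fwd_norm: "norm (evol A m n o\<^sub>L P n) \<le> (K + 1) * \<nu> n * (\<mu> m / \<mu> n) powr (- \<beta>)" if "n \<le> m" for m n
  proof (rule norm_blinfun_bound)
    show "0 \<le> (K + 1) * \<nu> n * (\<mu> m / \<mu> n) powr (- \<beta>)"
      using \<open>0 < K\<close> nu[of n] by simp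
    fix v
    have "evol A m n (G n v n) = G n v m"
      by (rule evol_orbit[OF that]) (simp add: G_step)
    then have "norm ((evol A m n o\<^sub>L P n) v) \<le> K * \<nu> n * (\<mu> m / \<mu> n) powr (- \<beta>) * norm v"
      using fwd by (simp add: P)
    also have "\<dots> \<le> (K + 1) * \<nu> n * (\<mu> m / \<mu> n) powr (- \<beta>) * norm v"
      using nu[of n] by (intro mult_right_mono) auto
    finally show "norm ((evol A m n o\<^sub>L P n) v) \<le> (K + 1) * \<nu> n * (\<mu> m / \<mu> n) powr (- \<beta>) * norm v" .
  qed
  have bwd_norm: "bounded_linear (\<lambda>v. evol_back A P m n (v - P n v)) \<and>
      onorm (\<lambda>v. evol_back A P m n (v - P n v)) \<le> (K + 1) * \<nu> n * (\<mu> n / \<mu> m) powr (- \<beta>)" if "m \<le> n" for m n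
  proof
    have "bounded_linear (\<lambda>v. impulse n v m)"
      by (cases "m = n") (auto simp: impulse_def bounded_linear_ident bounded_linear_zero)
    then show "bounded_linear (\<lambda>v. evol_back A P m n (v - P n v))"
      unfolding back_eq[OF that] by (intro bounded_linear_sub G_bl)
    show "onorm (\<lambda>v. evol_back A P m n (v - P n v)) \<le> (K + 1) * \<nu> n * (\<mu> n / \<mu> m) powr (- \<beta>)"
      unfolding back_eq[OF that]
    proof (rule onorm_bound)
      show "0 \<le> (K + 1) * \<nu> n * (\<mu> n / \<mu> m) powr (- \<beta>)"
        using \<open>0 < K\<close> nu[of n] by simp
      fix v :: 'a
      \<comment> \<open>The impulse is nonzero only for \<open>m = n\<close>, where the power is 1
        and \<open>1 \<le> \<nu> n\<close> suffices. This accounts for the summand 1 in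
        \<open>K + 1\<close>.\<close>
      have "norm (impulse n v m) \<le> \<nu> n * (\<mu> n / \<mu> m) powr (- \<beta>) * norm v"
        using pos[of n] nu[of n] mult_right_mono[OF nu[of n] norm_ge_zero[of v]] by (simp add: impulse_def)
      then show "norm (impulse n v m - G n v m) \<le> (K + 1) * \<nu> n * (\<mu> n / \<mu> m) powr (- \<beta>) * norm v"
        using norm_triangle_ineq4[of "impulse n v m" "G n v m"] bwd[of n v m]
        by (simp add: algebra_simps)
    qed
  qed
  show ?thesis
    unfolding dichotomy_def
  proof (intro exI[of _ P] conjI allI)
    show "A n o\<^sub>L P n = P (n + 1) o\<^sub>L A n" for n
      by (rule blinfun_eqI) (simp add: P_comm)
    show "\<exists>D>0. \<exists>a>0.
           (\<forall>m n. n \<le> m \<longrightarrow>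
              norm (evol A m n o\<^sub>L P n) \<le> D * \<nu> n * (\<mu> m / \<mu> n) powr (- a)) \<and>
           (\<forall>m n. m \<le> n \<longrightarrow>
              bounded_linear (\<lambda>x. evol_back A P m n (x - blinfun_apply (P n) x)) \<and>
              onorm (\<lambda>x. evol_back A P m n (x - blinfun_apply (P n) x))
                \<le> D * \<nu> n * (\<mu> n / \<mu> m) powr (- a))"
      using \<open>0 < K\<close> \<open>0 < \<beta>\<close> fwd_norm bwd_norm
      by (intro exI[of _ "K + 1"] exI[of _ \<beta>] conjI) auto
  qed (rule P_idem bij)+
qed

end

section \<open>The weighted spaces\<close>

lemma linf_space_impulse: "impulse n v \<in> linf_space \<mu> \<gamma>"
  unfolding linf_space_iff impulse_def by (intro exI[of _ "\<mu> n powr \<gamma> * norm v"]) auto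

lemma linf_space_restrict:
  assumes "x \<in> linf_space \<mu> \<gamma>"
  shows "(\<lambda>n. if n \<in> J then x n else 0) \<in> linf_space \<mu> \<gamma>"
proof -
  obtain C where C: "\<And>n. \<mu> n powr \<gamma> * norm (x n) \<le> C"
    using assms by (auto simp: linf_space_iff)
  moreover have "0 \<le> C"
    using C[of 0] by (meson order_trans mult_nonneg_nonneg norm_ge_zero powr_ge_zero)
  ultimately show ?thesis
    unfolding linf_space_iff by (intro exI[of _ C]) auto
qed

lemma linf_space_mono:
  assumes "x \<in> linf_space \<mu> \<gamma>" "\<And>n. \<mu>' n powr \<gamma>' \<le> \<mu> n powr \<gamma>"
  shows "x \<in> linf_space \<mu>' \<gamma>'"
  using assms unfolding linf_space_iff by (meson order_trans mult_right_mono norm_ge_zero)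

text \<open>\<open>unit_index\<close> is a definite description, so the threshold must be shown to
  exist and be unique. The limits give indices on both sides of the value 1, and by monotonicity the
  first crossing between them is the threshold.\<close>

lemma unit_index:
  assumes "growth_rate \<mu>"
  shows "\<And>n. n < unit_index \<mu> \<Longrightarrow> \<mu> n < 1" "\<And>n. unit_index \<mu> \<le> n \<Longrightarrow> 1 \<le> \<mu> n"
proof -
  have mono: "strict_mono \<mu>"
    using assms by (simp add: growth_rate_def)
  have "eventually (\<lambda>n. \<mu> n < 1) at_bot"
    using assms by (intro order_tendstoD(2)[of _ 0]) (auto simp: growth_rate_def)
  then obtain a where a: "\<mu> a < 1"
    by (auto simp: eventually_at_bot_linorder)
  have "eventually (\<lambda>n. 1 \<le> \<mu> n) at_top"
    using assms by (auto simp: growth_rate_def filterlim_at_top)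
  then obtain b where b: "1 \<le> \<mu> b"
    by (auto simp: eventually_at_top_linorder)
  then have "\<mu> a < \<mu> b"
    using a by simp
  then have "a < b"
    using mono by (simp add: strict_mono_less)
  then have ex: "\<exists>k. 1 \<le> \<mu> (a + int k)"
    using b by (intro exI[of _ "nat (b - a)"]) simp
  \<comment> \<open>Since \<open>\<mu> a < 1\<close>, the least \<open>k\<close> is positive, and
    its predecessor still gives a value below 1.\<close>
  define k where "k = (LEAST k. 1 \<le> \<mu> (a + int k))"
  have k: "1 \<le> \<mu> (a + int k)"
    unfolding k_def using ex by (rule LeastI_ex)
  have "k \<noteq> 0"
    using a k by (intro notI) simp
  then have "\<mu> (a + int (k - 1)) < 1"
    using not_less_Least[of "k - 1" "\<lambda>k. 1 \<le> \<mu> (a + int k)"] by (simp add: k_def not_le)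
  then have "\<mu> n < 1" if "n < a + int k" for n
    using that monoD[OF strict_mono_mono[OF mono], of n "a + int (k - 1)"] \<open>k \<noteq> 0\<close> by simp
  moreover have "1 \<le> \<mu> n" if "a + int k \<le> n" for n
    using that monoD[OF strict_mono_mono[OF mono], of "a + int k" n] k by simp
  ultimately have spec: "(\<forall>n<a + int k. \<mu> n < 1) \<and> (\<forall>n\<ge>a + int k. 1 \<le> \<mu> n)"
    by blast
  have "unit_index \<mu> = a + int k"
    unfolding unit_index_def
  proof (rule the_equality)
    show "(\<forall>n<a + int k. \<mu> n < 1) \<and> (\<forall>n\<ge>a + int k. 1 \<le> \<mu> n)"
      by (rule spec)
  next
    fix N assume N: "(\<forall>n<N. \<mu> n < 1) \<and> (\<forall>n\<ge>N. 1 \<le> \<mu> n)"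
    show "N = a + int k"
      using N spec by (metis linorder_neqE not_le order_refl)
  qed
  then show "\<And>n. n < unit_index \<mu> \<Longrightarrow> \<mu> n < 1" "\<And>n. unit_index \<mu> \<le> n \<Longrightarrow> 1 \<le> \<mu> n"
    using spec by auto
qed

text \<open>Folding the two-sided weight into one sequence, taken with exponent 1, makes the facts
  about \<open>linf_space\<close> available for \<open>linf_abs_space\<close>.\<close>

definition abs_weight :: "(int \<Rightarrow> real) \<Rightarrow> real \<Rightarrow> int \<Rightarrow> real" where
  "abs_weight \<mu> \<beta> n = \<mu> n powr (if n < unit_index \<mu> then \<bar>\<beta>\<bar> else - \<bar>\<beta>\<bar>)"

lemma linf_abs_space_eq: "linf_abs_space \<mu> \<beta> = linf_space (abs_weight \<mu> \<beta>) 1"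
proof -
  have "bdd_above (range (\<lambda>n. abs_weight \<mu> \<beta> n powr 1 * norm (x n))) \<longleftrightarrow>
      bdd_above ((\<lambda>n. \<mu> n powr \<bar>\<beta>\<bar> * norm (x n)) ` {..<unit_index \<mu>}) \<and>
      bdd_above ((\<lambda>n. \<mu> n powr (- \<bar>\<beta>\<bar>) * norm (x n)) ` {unit_index \<mu>..})" for x :: "int \<Rightarrow> 'a"
  proof -
    have "range (\<lambda>n. abs_weight \<mu> \<beta> n powr 1 * norm (x n)) =
      ((\<lambda>n. abs_weight \<mu> \<beta> n powr 1 * norm (x n)) ` {..<unit_index \<mu>}) \<union>
      ((\<lambda>n. abs_weight \<mu> \<beta> n powr 1 * norm (x n)) ` {unit_index \<mu>..})"
    proof -
      have "UNIV = {..<unit_index \<mu>} \<union> {unit_index \<mu>..}"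
        by auto
      then show ?thesis
        by (metis image_Un)
    qed
    also have "(\<lambda>n. abs_weight \<mu> \<beta> n powr 1 * norm (x n)) ` {..<unit_index \<mu>} =
        (\<lambda>n. \<mu> n powr \<bar>\<beta>\<bar> * norm (x n)) ` {..<unit_index \<mu>}"
      by (intro image_cong) (auto simp: abs_weight_def)
    also have "(\<lambda>n. abs_weight \<mu> \<beta> n powr 1 * norm (x n)) ` {unit_index \<mu>..} =
        (\<lambda>n. \<mu> n powr (- \<bar>\<beta>\<bar>) * norm (x n)) ` {unit_index \<mu>..}"
      by (intro image_cong) (auto simp: abs_weight_def)
    finally show ?thesis
      by simp
  qed
  then show ?thesis
    by (simp add: linf_abs_space_def linf_space_def)
qed

text \<open>Where \<open>\<mu> n < 1\<close> the exponent \<open>\<bar>\<beta>\<bar>\<close> gives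
  the smaller power, and where \<open>1 \<le> \<mu> n\<close> the exponent
  \<open>- \<bar>\<beta>\<bar>\<close> does. So the two-sided weight is the pointwise minimum of the
  weights for \<open>\<beta>\<close> and \<open>- \<beta>\<close>.\<close>

lemma linf_subset_linf_abs:
  assumes "growth_rate \<mu>" "\<bar>\<gamma>\<bar> = \<bar>\<beta>\<bar>" "x \<in> linf_space \<mu> \<gamma>"
  shows "x \<in> linf_abs_space \<mu> \<beta>"
  unfolding linf_abs_space_eq
proof (rule linf_space_mono[OF assms(3)])
  fix n
  have "0 < \<mu> n"
    using assms(1) by (simp add: growth_rate_def)
  show "abs_weight \<mu> \<beta> n powr 1 \<le> \<mu> n powr \<gamma>"
  proof (cases "n < unit_index \<mu>")
    case True
    then have "\<mu> n powr \<bar>\<beta>\<bar> \<le> \<mu> n powr \<gamma>"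
      using unit_index(1)[OF assms(1), of n] \<open>0 < \<mu> n\<close> assms(2) by (intro powr_mono') auto
    with True show ?thesis
      by (simp add: abs_weight_def)
  next
    case False
    then have "\<mu> n powr (- \<bar>\<beta>\<bar>) \<le> \<mu> n powr \<gamma>"
      using unit_index(2)[OF assms(1), of n] assms(2) by (intro powr_mono) auto
    with False show ?thesis
      by (simp add: abs_weight_def)
  qed
qed

section \<open>Combining the two exponents\<close>

theorem theorem4p2:
  fixes A :: "int \<Rightarrow> ('a::banach \<Rightarrow>\<^sub>L 'a)"
    and \<mu> \<nu> :: "int \<Rightarrow> real"
    and \<beta> :: real
  assumes "growth_rate \<mu>"
    and "\<forall>n. 1 \<le> \<nu> n"
    and "0 < \<beta>"
    and "\<forall>y \<in> l1_space \<mu> \<nu> \<beta>. \<exists>!x. x \<in> linf_space \<mu> \<beta> \<and>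
           (\<forall>n. x (n + 1) - blinfun_apply (A n) (x n) = y (n + 1))"
    and "\<forall>y \<in> l1_space \<mu> \<nu> (- \<beta>). \<exists>!x. x \<in> linf_space \<mu> (- \<beta>) \<and>
           (\<forall>n. x (n + 1) - blinfun_apply (A n) (x n) = y (n + 1))"
    and "\<forall>y \<in> l1_abs_space \<mu> \<nu> \<beta>. \<exists>!x. x \<in> linf_abs_space \<mu> \<beta> \<and>
           (\<forall>n. x (n + 1) - blinfun_apply (A n) (x n) = y (n + 1))"
  shows "dichotomy \<mu> \<nu> A"
proof -
  have pos: "0 < \<mu> n" for n
    using assms(1) by (simp add: growth_rate_def)
  have nu: "1 \<le> \<nu> n" "0 < \<nu> n" for n
    using assms(2) by (auto intro: less_le_trans[OF zero_less_one])
  have ex: "\<exists>!x. x \<in> linf_space \<mu> \<gamma> \<and> solves A x y"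
    if "\<gamma> \<in> {\<beta>, -\<beta>}" "y \<in> l1_space \<mu> \<nu> \<gamma>" for \<gamma> y
    using that assms(4,5) by (auto simp: solves_def)
  have in_l1: "impulse n v \<in> l1_space \<mu> \<nu> \<gamma>" for n v \<gamma>
    unfolding l1_space_def using impulse_summable_on by auto
  have abs_unique: "x = x'" if "x \<in> linf_abs_space \<mu> \<beta>" "x' \<in> linf_abs_space \<mu> \<beta>"
    "solves A x y" "solves A x' y" for x x' y
  proof -
    \<comment> \<open>The difference of two solutions solves the homogeneous equation, and the zero
      sequence lies in \<open>l1_abs_space\<close>; this extends uniqueness to arbitrary
      \<open>y\<close>.\<close>
    define d where "d n = x n + (-1) *\<^sub>R x' n" for n
    have "(\<lambda>_. 0) \<in> l1_abs_space \<mu> \<nu> \<beta>"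
      by (simp add: l1_abs_space_def)
    from assms(6)[rule_format, OF this, folded solves_def[of A _ "\<lambda>_. 0"]]
    have zero_unique: "z = z'" if "z \<in> linf_abs_space \<mu> \<beta> \<and> solves A z (\<lambda>_. 0)"
      "z' \<in> linf_abs_space \<mu> \<beta> \<and> solves A z' (\<lambda>_. 0)" for z z'
      using that by blast
    have "d = (\<lambda>_. 0)"
    proof (intro zero_unique conjI)
      show "d \<in> linf_abs_space \<mu> \<beta>"
        using that(1,2) unfolding d_def linf_abs_space_eq by (intro linf_space_add linf_space_scaleR)
      show "solves A d (\<lambda>_. 0)"
        using solves_add[OF that(3) solves_scaleR[OF that(4), of "-1"]] by (simp add: d_def[abs_def])
    qed (auto simp: linf_abs_space_eq linf_space_iff solves_def)
    then show ?thesis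
      by (auto simp: d_def fun_eq_iff)
  qed
  have "\<exists>K>0. \<forall>n v x. x \<in> linf_space \<mu> \<gamma> \<longrightarrow> solves A x (impulse n v) \<longrightarrow>
      (\<forall>m. \<mu> m powr \<gamma> * norm (x m) \<le> K * (\<mu> n powr \<gamma> * \<nu> n * norm v))" if "\<gamma> \<in> {\<beta>, -\<beta>}" for \<gamma>
    using that by (intro impulse_bound pos nu ex)
  then obtain K where K: "\<And>\<gamma>. \<gamma> \<in> {\<beta>, -\<beta>} \<Longrightarrow> 0 < K \<gamma>"
    and K_le: "\<And>\<gamma> n v x m. \<gamma> \<in> {\<beta>, -\<beta>} \<Longrightarrow> x \<in> linf_space \<mu> \<gamma> \<Longrightarrow> solves A x (impulse n v) \<Longrightarrow>
      \<mu> m powr \<gamma> * norm (x m) \<le> K \<gamma> * (\<mu> n powr \<gamma> * \<nu> n * norm v)"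
    by metis
  \<comment> \<open>A common constant for both exponents, since the two dichotomy estimates share
    one.\<close>
  define M where "M = max (K \<beta>) (K (-\<beta>))"
  have M: "x \<in> linf_space \<mu> \<gamma> \<Longrightarrow> solves A x (impulse n v) \<Longrightarrow>
      norm (x m) \<le> M * \<nu> n * (\<mu> m / \<mu> n) powr (- \<gamma>) * norm v" if "\<gamma> \<in> {\<beta>, -\<beta>}" for \<gamma> x n v m
  proof -
    assume "x \<in> linf_space \<mu> \<gamma>" "solves A x (impulse n v)"
    from K_le[OF that this, of m] have "norm (x m) \<le> K \<gamma> * (\<nu> n * (\<mu> m / \<mu> n) powr (- \<gamma>) * norm v)"
      using pos[of m] pos[of n] by (simp add: powr_divide powr_minus field_simps)
    also have "\<dots> \<le> M * (\<nu> n * (\<mu> m / \<mu> n) powr (- \<gamma>) * norm v)"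
      using that nu(1)[of n] by (intro mult_right_mono) (auto simp: M_def)
    finally show ?thesis
      by (simp add: mult.assoc)
  qed
  have "\<exists>x. x \<in> linf_space \<mu> \<beta> \<and> x \<in> linf_space \<mu> (-\<beta>) \<and> solves A x (impulse n v)" for n v
  proof -
    obtain x x' where x: "x \<in> linf_space \<mu> \<beta>" "solves A x (impulse n v)"
      and x': "x' \<in> linf_space \<mu> (-\<beta>)" "solves A x' (impulse n v)"
      using ex[OF _ in_l1, of \<beta> n v] ex[OF _ in_l1, of "-\<beta>" n v] by blast
    have "x = x'"
      using x x' assms(1) by (intro abs_unique[of x x'] linf_subset_linf_abs[of \<mu> _ \<beta>]) auto
    then show ?thesis
      using x x' by blast
  qed
  then obtain G where G: "\<And>n v. G n v \<in> linf_space \<mu> \<beta>" "\<And>n v. G n v \<in> linf_space \<mu> (-\<beta>)"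
    "\<And>n v. solves A (G n v) (impulse n v)"
    by metis
  interpret green_function A "linf_abs_space \<mu> \<beta>" G
  proof
    show "G n v \<in> linf_abs_space \<mu> \<beta>" for n v
      by (rule linf_subset_linf_abs[OF assms(1) _ G(1)]) simp
  qed (simp_all add: linf_abs_space_eq linf_space_add linf_space_scaleR linf_space_impulse
      linf_space_restrict G abs_unique[unfolded linf_abs_space_eq])
  show ?thesis
  proof (rule dichotomy_if_bounded[OF pos nu(1) _ assms(3), of M])
    show "0 < M"
      using K[of \<beta>] by (simp add: M_def less_max_iff_disj)
    show "norm (G n v m) \<le> M * \<nu> n * (\<mu> m / \<mu> n) powr (- \<beta>) * norm v" for n v m
      by (rule M) (auto simp: G)
    \<comment> \<open>The exponent \<open>- \<beta>\<close> inverts the ratio and so yields the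
      backward bound.\<close>
    have "norm (G n v m) \<le> M * \<nu> n * (\<mu> m / \<mu> n) powr (- (- \<beta>)) * norm v" for n v m
      by (rule M) (auto simp: G)
    moreover have "(\<mu> m / \<mu> n) powr (- (- \<beta>)) = (\<mu> n / \<mu> m) powr (- \<beta>)" for m n
      using pos[of m] pos[of n] by (simp add: powr_divide powr_minus field_simps)
    ultimately show "norm (G n v m) \<le> M * \<nu> n * (\<mu> n / \<mu> m) powr (- \<beta>) * norm v" for n v m
      by simp
  qed
qed

end
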